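(* Let $\varrho=X(a,b,c)$ be a three qubit X-state, with $a,b\in\mathbb R^4$ and $c\in\mathbb C^4$. Then $\varrho$ is separable if and only if $$\Delta_\varrho\ \ge\ \|c\|_{\mathsf X}'.$$
   Context: For $a,b\in\mathbb R^4$ and $c\in\mathbb C^4$, $X(a,b,c)$ denotes the $8\times 8$ self-adjoint matrix, regarded as an element of $M_2\otimes M_2\otimes M_2$ (complex $2\times 2$ matrices, basis indices $000,001,\dots,111$ in lexicographic order), whose diagonal is $(a_1,a_2,a_3,a_4,b_4,b_3,b_2,b_1)$, whose anti-diagonal entries, read from the top-right corner to the bottom-left corner, are $(c_1,c_2,c_3,c_4,\bar c_4,\bar c_3,\bar c_2,\bar c_1)$, and all of whose other entries are zero. A (three qubit) state is a positive semidefinite matrix in $M_2\otimes M_2\otimes M_2$; normalization of the trace is disregarded. An X-state is a state of the form $X(a,b,c)$. A state is separable if it is a sum of pure product states, i.e. of rank one projections, up to positive scalars, onto product vectors $x\otimes y\otimes w$ with $x,y,w\in\mathbb C^2$. For $\varrho=X(a,b,c)$, $$\Delta_\varrho=\min\{\sqrt{a_1b_1},\sqrt{a_2b_2},\sqrt{a_3b_3},\sqrt{a_4b_4},\sqrt[4]{a_1b_2b_3a_4},\sqrt[4]{b_1a_2a_3b_4}\}.$$ On $\mathbb C^4$ define the norm $\|z\|_{\mathsf X}=\max_{\sigma\in\mathbb R}\left(|z_1e^{\mathrm i\sigma}+\bar z_4|+|z_2e^{\mathrm i\sigma}+\bar z_3|\right)$ and its dual norm $\|c\|_{\mathsf X}'=\max\{|\langle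 c,z\rangle|:\|z\|_{\mathsf X}=1\}$, where $\langle c,z\rangle=\sum_{i=1}^4c_iz_i$ (bilinear). *)

theory Defs
  imports "HOL-Analysis.Analysis"
begin

text \<open>
  The space \<open>M\<^sub>2 \<otimes> M\<^sub>2 \<otimes> M\<^sub>2\<close> is represented by the complex matrices indexed by
  triples of bits, a bit being an element \<open>0\<close> or \<open>1\<close> of the two-element type \<open>2\<close>.
\<close>

type_synonym bits3 = "2 \<times> 2 \<times> 2"
type_synonym three_qubit_vector = "(complex, bits3) vec"
type_synonym three_qubit_matrix = "((complex, bits3) vec, bits3) vec"

definition bit_val :: "2 \<Rightarrow> nat" where
  "bit_val i = (if i = 0 then 0 else 1)"

text \<open>Position, from \<open>0\<close> to \<open>7\<close>, in the lexicographic order \<open>000, 001, \<dots>, 111\<close>.\<close>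

definition lex_pos :: "bits3 \<Rightarrow> nat" where
  "lex_pos p = (case p of (i, j, k) \<Rightarrow> 4 * bit_val i + 2 * bit_val j + bit_val k)"

text \<open>
  In the type \<open>4\<close> the numeral \<open>4\<close> denotes the same element as \<open>0\<close>, so that
  \<open>1, 2, 3, 4\<close> are its four elements and \<open>a $ 1, \<dots>, a $ 4\<close> the four entries of \<open>a\<close>.
\<close>

definition X_matrix :: "real ^ 4 \<Rightarrow> real ^ 4 \<Rightarrow> complex ^ 4 \<Rightarrow> three_qubit_matrix" where
  "X_matrix a b c = (\<chi> p q.
     if lex_pos p = lex_pos q then
       complex_of_real ([a$1, a$2, a$3, a$4, b$4, b$3, b$2, b$1] ! lex_pos p)
     else if lex_pos p + lex_pos q = 7 then
       [c$1, c$2, c$3, c$4, cnj (c$4), cnj (c$3), cnj (c$2), cnj (c$1)] ! lex_pos p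
     else 0)"

text \<open>
  States are not normalized; in particular the zero matrix is a state.
\<close>

definition state :: "three_qubit_matrix \<Rightarrow> bool" where
  "state A \<longleftrightarrow>
     (\<forall>p q. A $ q $ p = cnj (A $ p $ q)) \<and>
     (\<forall>v :: three_qubit_vector. 0 \<le> Re (\<Sum>p\<in>UNIV. cnj (v $ p) * (A *v v) $ p))"

definition product_vector :: "complex ^ 2 \<Rightarrow> complex ^ 2 \<Rightarrow> complex ^ 2 \<Rightarrow> three_qubit_vector" where
  "product_vector x y w = (\<chi> p. case p of (i, j, k) \<Rightarrow> x $ i * y $ j * w $ k)"

text \<open>The orthogonal projection \<open>v v\<^sup>* / \<parallel>v\<parallel>\<^sup>2\<close> onto the line spanned by \<open>v \<noteq> 0\<close>.\<close>

definition rank_one_projection :: "three_qubit_vector \<Rightarrow> three_qubit_matrix" where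
  "rank_one_projection v = (1 / (norm v)\<^sup>2) *\<^sub>R (\<chi> p q. v $ p * cnj (v $ q))"

definition pure_product_state :: "three_qubit_matrix \<Rightarrow> bool" where
  "pure_product_state A \<longleftrightarrow>
     (\<exists>t x y w. 0 < t \<and> product_vector x y w \<noteq> 0 \<and>
        A = t *\<^sub>R rank_one_projection (product_vector x y w))"

text \<open>The empty sum is allowed, so that the zero state is separable.\<close>

definition separable :: "three_qubit_matrix \<Rightarrow> bool" where
  "separable A \<longleftrightarrow>
     (\<exists>(n::nat) F. (\<forall>k<n. pure_product_state (F k)) \<and> A = (\<Sum>k<n. F k))"

definition Delta :: "real ^ 4 \<Rightarrow> real ^ 4 \<Rightarrow> real" where
  "Delta a b = Min
     {sqrt (a$1 * b$1), sqrt (a$2 * b$2), sqrt (a$3 * b$3), sqrt (a$4 * b$4),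
      root 4 (a$1 * b$2 * b$3 * a$4), root 4 (b$1 * a$2 * a$3 * b$4)}"

text \<open>
  The maxima in the next two definitions range over infinite sets and are written as
  suprema. Both are attained: the first function is continuous and \<open>2\<pi>\<close>-periodic
  in \<open>\<sigma>\<close>, and the unit sphere of a norm on \<open>\<complex>\<^sup>4\<close> is compact.
\<close>

definition X_norm :: "complex ^ 4 \<Rightarrow> real" where
  "X_norm z = (SUP \<sigma>::real.
     cmod (z$1 * exp (\<i> * complex_of_real \<sigma>) + cnj (z$4)) +
     cmod (z$2 * exp (\<i> * complex_of_real \<sigma>) + cnj (z$3)))"

definition X_dual_norm :: "complex ^ 4 \<Rightarrow> real" where
  "X_dual_norm c = (SUP z\<in>{z. X_norm z = 1}. cmod (\<Sum>i\<in>UNIV. c $ i * z $ i))"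

end

theory Submission
  imports Defs
begin

text \<open>
  The dual unit ball of \<open>X_norm\<close> is the convex hull of the points
  \<open>u\<close> of the torus \<open>|u\<^sub>i| = 1\<close> with \<open>u\<^sub>1 u\<^sub>4 = u\<^sub>2 u\<^sub>3\<close>. The anti-diagonal of a pure product
  state has this form up to a factor \<open>r\<close>, and the six terms in its \<open>Delta\<close> all equal \<open>r\<close>; summing
  over a decomposition, the Cauchy-Schwarz inequality gives necessity. Conversely, separability
  of \<open>X(a, b, c)\<close> is a convex condition on \<open>c\<close>, so it suffices to treat \<open>c = r u\<close> with
  \<open>0 < r \<le> Delta\<close> (for \<open>r = 0\<close> the matrix is diagonal). Subtracting a nonnegative diagonal
  matrix reduces to \<open>a\<^sub>i b\<^sub>i = r\<^sup>2\<close> and \<open>a\<^sub>1 a\<^sub>4 = a\<^sub>2 a\<^sub>3\<close>, where \<open>X(a, b, c)\<close> is an average of four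
  pure product states that differ by signs.
\<close>

subsection \<open>The norm and its dual\<close>

definition X_norm_at :: "complex ^ 4 \<Rightarrow> real \<Rightarrow> real" where
  "X_norm_at z \<sigma> = cmod (z$1 * exp (\<i> * complex_of_real \<sigma>) + cnj (z$4)) +
     cmod (z$2 * exp (\<i> * complex_of_real \<sigma>) + cnj (z$3))"

lemma X_norm_eq_SUP: "X_norm z = (SUP \<sigma>. X_norm_at z \<sigma>)"
  by (simp add: X_norm_def X_norm_at_def)

lemma X_norm_at_le: "X_norm_at z \<sigma> \<le> (\<Sum>i\<in>UNIV. cmod (z $ i))"
  using norm_triangle_ineq[of "z$1 * exp (\<i> * complex_of_real \<sigma>)" "cnj (z$4)"]
    norm_triangle_ineq[of "z$2 * exp (\<i> * complex_of_real \<sigma>)" "cnj (z$3)"]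
  by (simp add: X_norm_at_def sum_4 norm_mult)

lemma X_norm_at_le_X_norm: "X_norm_at z \<sigma> \<le> X_norm z"
  unfolding X_norm_eq_SUP
  by (rule cSUP_upper) (auto intro!: bdd_aboveI2 X_norm_at_le)

lemma X_norm_scaleR:
  assumes "0 \<le> t"
  shows "X_norm (t *\<^sub>R z) = t * X_norm z"
proof -
  have "X_norm_at (t *\<^sub>R z) \<sigma> = t * X_norm_at z \<sigma>" for \<sigma>
  proof -
    have "cmod (t *\<^sub>R x * e + cnj (t *\<^sub>R y)) = t * cmod (x * e + cnj y)" for x y e :: complex
    proof -
      have "t *\<^sub>R x * e + cnj (t *\<^sub>R y) = t *\<^sub>R (x * e + cnj y)"
        by (simp add: scaleR_add_right)
      then show ?thesis using assms by simp
    qed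
    then show ?thesis by (simp add: X_norm_at_def distrib_left)
  qed
  \<comment> \<open>Multiplication by \<open>t\<close> is monotone and continuous, so it commutes
    with the supremum of a bounded nonempty set.\<close>
  moreover have "(SUP \<sigma>. t * X_norm_at z \<sigma>) = t * (SUP \<sigma>. X_norm_at z \<sigma>)"
  proof (rule continuous_at_Sup_mono[where f = "\<lambda>x. t * x" and S = "range (X_norm_at z)",
        unfolded image_image, symmetric])
    show "mono (\<lambda>x. t * x)" using assms by (intro monoI mult_left_mono)
    show "bdd_above (range (X_norm_at z))" by (auto intro!: bdd_aboveI2 X_norm_at_le)
  qed (auto intro!: continuous_intros)
  ultimately show ?thesis by (simp add: X_norm_eq_SUP)
qed

text \<open>Passing from angle 0 to angle pi flips the signs of z1 and z2, and by the triangle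
  inequality the two values add up to at least twice each modulus. Definiteness of
  \<open>X_norm\<close> and boundedness of its unit sphere follow.\<close>

lemma norm_component_le_X_norm: "cmod (z $ i) \<le> X_norm z"
proof -
  have 0: "cmod (z$1 + cnj (z$4)) + cmod (z$2 + cnj (z$3)) \<le> X_norm z"
    using X_norm_at_le_X_norm[of z 0] by (simp add: X_norm_at_def)
  have 1: "cmod (- (z$1) + cnj (z$4)) + cmod (- (z$2) + cnj (z$3)) \<le> X_norm z"
    using X_norm_at_le_X_norm[of z pi] by (simp add: X_norm_at_def)
  have double: "cmod x \<le> m \<and> cmod y \<le> m \<and> cmod x' \<le> m \<and> cmod y' \<le> m"
    if "cmod (x + y) + cmod (x' + y') \<le> m" "cmod (- x + y) + cmod (- x' + y') \<le> m" for x y x' y' m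
  proof -
    have 1: "2 * cmod x \<le> cmod (x + y) + cmod (- x + y)" for x y :: complex
    proof -
      have "(x + y) - (- x + y) = 2 * x" by simp
      then show ?thesis using norm_triangle_ineq4[of "x + y" "- x + y"]
        by (simp only: norm_mult norm_numeral)
    qed
    have 2: "2 * cmod y \<le> cmod (x + y) + cmod (- x + y)" for x y :: complex
    proof -
      have "(x + y) + (- x + y) = 2 * y" by simp
      then show ?thesis using norm_triangle_ineq[of "x + y" "- x + y"]
        by (simp only: norm_mult norm_numeral)
    qed
    show ?thesis
      using that 1[of x y] 1[of x' y'] 2[of y x] 2[of y' x']
        norm_ge_zero[of "x + y"] norm_ge_zero[of "x' + y'"]
        norm_ge_zero[of "- x + y"] norm_ge_zero[of "- x' + y'"]
      by linarith
  qed
  have "cmod (z$1) \<le> X_norm z" "cmod (z$4) \<le> X_norm z" "cmod (z$2) \<le> X_norm z" "cmod (z$3) \<le> X_norm z"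
    using double[OF 0 1] by (simp_all only: complex_mod_cnj)
  then show ?thesis using exhaust_4[of i] by metis
qed

lemma X_norm_nonneg: "0 \<le> X_norm z"
  using norm_component_le_X_norm[of z 1] norm_ge_zero[of "z $ 1"] by linarith

lemma X_norm_eq_0_imp: "X_norm z = 0 \<Longrightarrow> z = 0"
  using norm_component_le_X_norm[of z] by (simp add: vec_eq_iff)

lemma bdd_above_X_dual_norm:
  "bdd_above ((\<lambda>z. cmod (\<Sum>i\<in>UNIV. c $ i * z $ i)) ` {z. X_norm z = 1})"
proof (rule bdd_aboveI2)
  fix z assume "z \<in> {z. X_norm z = 1}"
  then have "cmod (z $ i) \<le> 1" for i using norm_component_le_X_norm[of z i] by simp
  then show "cmod (\<Sum>i\<in>UNIV. c $ i * z $ i) \<le> (\<Sum>i\<in>UNIV. cmod (c $ i))"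
    by (intro sum_norm_le) (simp add: norm_mult mult_left_le)
qed

text \<open>Rescale to the unit sphere, over which \<open>X_dual_norm\<close> is a supremum;
  definiteness of \<open>X_norm\<close> settles the case of norm zero.\<close>

lemma norm_pairing_le: "cmod (\<Sum>i\<in>UNIV. c $ i * z $ i) \<le> X_dual_norm c * X_norm z"
proof (cases "X_norm z = 0")
  case True
  then have "z = 0" by (rule X_norm_eq_0_imp)
  then show ?thesis using True by simp
next
  case False
  then have pos: "0 < X_norm z" using X_norm_nonneg[of z] by linarith
  define z' where "z' = (1 / X_norm z) *\<^sub>R z"
  have "X_norm z' = 1" using pos by (simp add: z'_def X_norm_scaleR)
  then have "cmod (\<Sum>i\<in>UNIV. c $ i * z' $ i) \<le> X_dual_norm c"
    unfolding X_dual_norm_def by (intro cSUP_upper bdd_above_X_dual_norm) simp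
  moreover have "(\<Sum>i\<in>UNIV. c $ i * z' $ i) = (1 / X_norm z) *\<^sub>R (\<Sum>i\<in>UNIV. c $ i * z $ i)"
    by (simp add: z'_def scaleR_sum_right)
  ultimately have "1 / X_norm z * cmod (\<Sum>i\<in>UNIV. c $ i * z $ i) \<le> X_dual_norm c"
    using pos by (simp only: norm_scaleR abs_of_pos zero_less_divide_1_iff)
  then show ?thesis using pos by (simp only: times_divide_eq_left mult_1 pos_divide_le_eq)
qed

text \<open>A supremum over the empty set is unspecified, so the nonnegativity of
  \<open>X_dual_norm\<close> and its upper bounds by \<open>cSUP_least\<close> rest on this.\<close>

lemma X_norm_1_nonempty: "{z. X_norm z = 1} \<noteq> {}"
proof -
  define e where "e = (axis 1 1 :: complex ^ 4)"
  have "X_norm e \<noteq> 0"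
    using X_norm_eq_0_imp[of e] by (auto simp: e_def axis_eq_0_iff)
  then have "X_norm ((1 / X_norm e) *\<^sub>R e) = 1"
    using X_norm_nonneg[of e] by (simp add: X_norm_scaleR)
  then show ?thesis by blast
qed

lemma X_dual_norm_nonneg: "0 \<le> X_dual_norm c"
proof -
  obtain z where "X_norm z = 1" using X_norm_1_nonempty by blast
  then have "cmod (\<Sum>i\<in>UNIV. c $ i * z $ i) \<le> X_dual_norm c"
    using norm_pairing_le[of c z] by (simp only: mult_1_right)
  then show ?thesis using norm_ge_zero order_trans by metis
qed

subsection \<open>The dual ball as a convex hull\<close>

lemma vector_4:
  "(vector [w, x, y, z] :: 'a::zero ^ 4) $ 1 = w"
  "(vector [w, x, y, z] :: 'a::zero ^ 4) $ 2 = x"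
  "(vector [w, x, y, z] :: 'a::zero ^ 4) $ 3 = y"
  "(vector [w, x, y, z] :: 'a::zero ^ 4) $ 4 = z"
  by (simp_all add: vector_def)

text \<open>The radius is a parameter because the terms of a separable decomposition have different
  moduli; radius 0 leaves only the origin.\<close>

definition phase_torus :: "real \<Rightarrow> (complex ^ 4) set" where
  "phase_torus r = {u. (\<forall>i. cmod (u $ i) = r) \<and> u$1 * u$4 = u$2 * u$3}"

lemma Re_mult_le_cmod_unit:
  assumes "cmod u = 1"
  shows "Re (u * x) \<le> cmod x"
  using complex_Re_le_cmod[of "u * x"] assms by (simp add: norm_mult)

text \<open>The relation u1 u4 = u2 u3 lets one angle \<sigma>, the argument of this product, serve
  both pairs (1,4) and (2,3). Multiplying x v w + cnj y by the unit cnj w gives v x + cnj (w y),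
  with the same real part as v x + w y.\<close>

lemma Re_pairing_unit_torus_le:
  assumes "u \<in> phase_torus 1"
  shows "Re (\<Sum>i\<in>UNIV. u $ i * z $ i) \<le> X_norm z"
proof -
  have unit: "cmod (u $ i) = 1" for i using assms by (simp add: phase_torus_def)
  have prod: "u$1 * u$4 = u$2 * u$3" using assms by (simp add: phase_torus_def)
  obtain \<sigma> where \<sigma>: "u$1 * u$4 = exp (\<i> * complex_of_real \<sigma>)"
  proof
    have "cmod (u$1 * u$4) = 1" using unit by (simp add: norm_mult)
    moreover from this have "u$1 * u$4 \<noteq> 0" by force
    ultimately show "u$1 * u$4 = exp (\<i> * complex_of_real (Arg (u$1 * u$4)))"
      using Arg_eq[of "u$1 * u$4"] by simp
  qed
  have pair: "Re (v * x + w * y) \<le> cmod (x * (v * w) + cnj y)" if "cmod v = 1" "cmod w = 1" for v w x y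
  proof -
    have w: "w * cnj w = 1" using that by (simp add: complex_norm_square[symmetric])
    have "cnj w * (x * (v * w) + cnj y) = (w * cnj w) * (v * x) + cnj (w * y)"
      by (simp add: algebra_simps)
    then have "Re (v * x + w * y) = Re (cnj w * (x * (v * w) + cnj y))" unfolding w by simp
    also have "\<dots> \<le> cmod (x * (v * w) + cnj y)"
      using that by (intro Re_mult_le_cmod_unit) simp
    finally show ?thesis .
  qed
  have "Re (\<Sum>i\<in>UNIV. u $ i * z $ i) = Re (u$1 * z$1 + u$4 * z$4) + Re (u$2 * z$2 + u$3 * z$3)"
    by (simp add: sum_4)
  also have "\<dots> \<le> X_norm_at z \<sigma>"
    unfolding X_norm_at_def using \<sigma> prod unit pair[of "u$1" "u$4" "z$1" "z$4"] pair[of "u$2" "u$3" "z$2" "z$3"]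
    by simp
  finally show ?thesis using X_norm_at_le_X_norm order_trans by blast
qed

lemma unit_multiplier: "\<exists>u. cmod u = 1 \<and> u * x = complex_of_real (cmod x)" for x :: complex
proof (cases "x = 0")
  case True
  then show ?thesis by (intro exI[of _ 1]) simp
next
  case False
  have "cnj x * x = complex_of_real (cmod x) * complex_of_real (cmod x)"
    by (metis complex_norm_square mult.commute of_real_mult power2_eq_square of_real_power)
  then have "cnj x / complex_of_real (cmod x) * x = complex_of_real (cmod x)"
    using False by simp
  moreover have "cmod (cnj x / complex_of_real (cmod x)) = 1"
    using False by (simp add: norm_divide)
  ultimately show ?thesis by blast
qed

text \<open>A rotation by a unit \<omega> makes the pairing real and nonnegative. The torus relation
  is homogeneous, so the rotated and rescaled point stays on the unit torus.\<close>

lemma cmod_pairing_torus_le: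
  assumes C: "C \<in> phase_torus r"
  shows "cmod (\<Sum>i\<in>UNIV. C $ i * z $ i) \<le> r * X_norm z"
proof -
  have norm: "cmod (C $ i) = r" for i using C by (simp add: phase_torus_def)
  show ?thesis
  proof (cases "r = 0")
    case True
    then show ?thesis using norm by simp
  next
    case False
    then have r: "0 < r" using norm[of 1] norm_ge_zero[of "C $ 1"] by linarith
    obtain \<omega> where \<omega>: "cmod \<omega> = 1"
      "\<omega> * (\<Sum>i\<in>UNIV. C $ i * z $ i) = complex_of_real (cmod (\<Sum>i\<in>UNIV. C $ i * z $ i))"
      using unit_multiplier by blast
    define u :: "complex ^ 4" where "u = (\<chi> i. \<omega> * (C $ i) / complex_of_real r)"
    have u: "u \<in> phase_torus 1"
      using C r \<omega> by (simp add: phase_torus_def u_def norm_mult norm_divide)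
    have "(\<Sum>i\<in>UNIV. C $ i * z $ i) * \<omega> = complex_of_real r * (\<Sum>i\<in>UNIV. u $ i * z $ i)"
      using r by (simp add: u_def sum_distrib_left sum_distrib_right mult_ac)
    then have "complex_of_real (cmod (\<Sum>i\<in>UNIV. C $ i * z $ i)) = complex_of_real r * (\<Sum>i\<in>UNIV. u $ i * z $ i)"
      using \<omega> by (simp add: mult.commute)
    then have "Re (complex_of_real (cmod (\<Sum>i\<in>UNIV. C $ i * z $ i))) = Re (r *\<^sub>R (\<Sum>i\<in>UNIV. u $ i * z $ i))"
      by (simp only: scaleR_conv_of_real)
    then have "cmod (\<Sum>i\<in>UNIV. C $ i * z $ i) = r * Re (\<Sum>i\<in>UNIV. u $ i * z $ i)"
      by (simp only: Re_complex_of_real scaleR_complex.sel)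
    then show ?thesis using Re_pairing_unit_torus_le[OF u, of z] r by (simp add: mult_left_mono)
  qed
qed

text \<open>Converse of the preceding bounds: every value \<open>X_norm_at z \<sigma>\<close> is
  attained by a torus point, so \<open>X_norm\<close> is the support function of the unit
  torus.\<close>

lemma mult_X_norm_le_if_phase_torus_le:
  assumes r: "0 \<le> r" and bound: "\<And>u. u \<in> phase_torus r \<Longrightarrow> Re (\<Sum>i\<in>UNIV. u $ i * z $ i) \<le> d"
  shows "r * X_norm z \<le> d"
proof -
  have le: "r * X_norm_at z \<sigma> \<le> d" for \<sigma>
  proof -
    define e where "e = exp (\<i> * complex_of_real \<sigma>)"
    have e: "cmod e = 1" by (simp add: e_def)
    obtain \<alpha> where \<alpha>: "cmod \<alpha> = 1" "\<alpha> * (z$1 * e + cnj (z$4)) = complex_of_real (cmod (z$1 * e + cnj (z$4)))"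
      using unit_multiplier by blast
    obtain \<beta> where \<beta>: "cmod \<beta> = 1" "\<beta> * (z$2 * e + cnj (z$3)) = complex_of_real (cmod (z$2 * e + cnj (z$3)))"
      using unit_multiplier by blast
    have unit: "\<alpha> * cnj \<alpha> = 1" "\<beta> * cnj \<beta> = 1"
      using \<alpha> \<beta> by (simp_all add: complex_norm_square[symmetric])
    define R where "R = complex_of_real r"
    \<comment> \<open>The units \<alpha> and \<beta> rotate the two summands of
      \<open>X_norm_at z \<sigma>\<close> to their moduli; both u1 u4 and u2 u3 equal R^2 e.\<close>
    define u :: "complex ^ 4" where "u = vector [R * \<alpha> * e, R * \<beta> * e, R * cnj \<beta>, R * cnj \<alpha>]"
    have "u \<in> phase_torus r"
      using \<alpha> \<beta> e r unit by (simp add: phase_torus_def u_def forall_4 norm_mult R_def vector_4)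
    moreover have "Re (\<Sum>i\<in>UNIV. u $ i * z $ i) = r * X_norm_at z \<sigma>"
    proof -
      have "Re (\<Sum>i\<in>UNIV. u $ i * z $ i) =
        r * (Re (\<alpha> * e * z$1 + cnj (\<alpha> * cnj (z$4))) + Re (\<beta> * e * z$2 + cnj (\<beta> * cnj (z$3))))"
        by (simp add: sum_4 u_def vector_4 R_def algebra_simps)
      also have "\<dots> = r * (Re (\<alpha> * (z$1 * e + cnj (z$4))) + Re (\<beta> * (z$2 * e + cnj (z$3))))"
        by (simp add: algebra_simps)
      finally show ?thesis unfolding \<alpha> \<beta> by (simp add: X_norm_at_def e_def)
    qed
    ultimately show ?thesis using bound by metis
  qed
  show ?thesis
  proof (cases "r = 0")
    case True
    then show ?thesis using le by simp
  next
    case False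
    then have "X_norm z \<le> d / r"
      unfolding X_norm_eq_SUP using r le by (intro cSUP_least) (auto simp: field_simps)
    then show ?thesis using r False by (simp add: field_simps)
  qed
qed

lemma compact_phase_torus: "compact (phase_torus r)"
proof -
  have "phase_torus r \<subseteq> cball 0 (4 * r)"
  proof
    fix u assume "u \<in> phase_torus r"
    then have "\<And>i. norm (u $ i) = r" by (simp add: phase_torus_def)
    then show "u \<in> cball 0 (4 * r)"
      using norm_ge_zero[of "u $ 1"] L2_set_le_sum[of UNIV "\<lambda>i::4. r"] by (simp add: norm_vec_def)
  qed
  then have "bounded (phase_torus r)" using bounded_cball bounded_subset by blast
  moreover have "closed (phase_torus r)"
    unfolding phase_torus_def
    by (intro closed_Collect_conj closed_Collect_all closed_Collect_eq continuous_intros)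
  ultimately show ?thesis by (simp add: compact_eq_bounded_closed)
qed

text \<open>A strictly separating hyperplane would give a \<open>z\<close> whose pairing with
  \<open>c\<close> exceeds the support function of the torus, contradicting
  \<open>norm_pairing_le\<close>.\<close>

lemma in_convex_hull_phase_torus: "c \<in> convex hull (phase_torus (X_dual_norm c))"
proof (rule ccontr)
  let ?r = "X_dual_norm c"
  assume "c \<notin> convex hull (phase_torus ?r)"
  moreover have "closed (convex hull (phase_torus ?r))"
    by (intro compact_imp_closed compact_convex_hull compact_phase_torus)
  ultimately obtain g d where g: "inner g c < d" "\<forall>x\<in>convex hull (phase_torus ?r). inner g x > d"
    using separating_hyperplane_closed_point[OF convex_convex_hull] by metis
  \<comment> \<open>Conjugation turns the real inner product into the real part of the bilinear
    pairing; the sign turns the lower bound on the hull into an upper one.\<close>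
  define z :: "complex ^ 4" where "z = (\<chi> i. - cnj (g $ i))"
  have inner: "inner g x = - Re (\<Sum>i\<in>UNIV. x $ i * z $ i)" for x
    by (simp add: inner_vec_def inner_complex_def z_def sum_4)
  have "?r * X_norm z \<le> - d"
  proof (rule mult_X_norm_le_if_phase_torus_le[OF X_dual_norm_nonneg])
    fix u assume "u \<in> phase_torus ?r"
    then have "inner g u > d" using g hull_inc by metis
    then show "Re (\<Sum>i\<in>UNIV. u $ i * z $ i) \<le> - d" by (simp add: inner)
  qed
  moreover have "Re (\<Sum>i\<in>UNIV. c $ i * z $ i) \<le> ?r * X_norm z"
    using complex_Re_le_cmod norm_pairing_le order_trans by blast
  ultimately show False using g(1) by (simp add: inner)
qed

subsection \<open>The cone of separable matrices\<close>

text \<open>Unnormalised and allowed to vanish, so that the constructions below carry no side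
  condition on the product vector.\<close>

definition outer_product :: "three_qubit_vector \<Rightarrow> three_qubit_matrix" where
  "outer_product v = (\<chi> p q. v $ p * cnj (v $ q))"

lemma separable_0: "separable 0"
  unfolding separable_def by (intro exI[of _ 0]) simp

lemma separable_add:
  assumes "separable A" "separable B"
  shows "separable (A + B)"
proof -
  obtain m :: nat and F where F: "\<forall>k<m. pure_product_state (F k)" "A = (\<Sum>k<m. F k)"
    using assms(1) unfolding separable_def by blast
  obtain n :: nat and G where G: "\<forall>k<n. pure_product_state (G k)" "B = (\<Sum>k<n. G k)"
    using assms(2) unfolding separable_def by blast
  define H where "H = (\<lambda>k. if k < m then F k else G (k - m))"
  have "(\<Sum>k<m + n. H k) = (\<Sum>k<m. H k) + (\<Sum>k<n. H (m + k))"
    by (induction n) (simp_all add: add.assoc)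
  then have "A + B = (\<Sum>k<m + n. H k)" using F G by (simp add: H_def)
  moreover have "\<forall>k<m + n. pure_product_state (H k)" using F G by (auto simp: H_def)
  ultimately show ?thesis unfolding separable_def by blast
qed

lemma separable_scaleR:
  assumes "separable A" "0 \<le> t"
  shows "separable (t *\<^sub>R A)"
proof (cases "t = 0")
  case True
  then show ?thesis by (simp add: separable_0)
next
  case False
  obtain n :: nat and F where F: "\<forall>k<n. pure_product_state (F k)" "A = (\<Sum>k<n. F k)"
    using assms(1) unfolding separable_def by blast
  have "pure_product_state (t *\<^sub>R F k)" if k: "k < n" for k
  proof -
    obtain s x y w where "0 < s" "product_vector x y w \<noteq> 0"
      "F k = s *\<^sub>R rank_one_projection (product_vector x y w)"
      using F(1) k unfolding pure_product_state_def by blast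
    then show ?thesis using assms(2) False unfolding pure_product_state_def
      by (intro exI[of _ "t * s"] exI[of _ x] exI[of _ y] exI[of _ w]) simp
  qed
  then show ?thesis unfolding separable_def F(2)
    by (intro exI[of _ n] exI[of _ "\<lambda>k. t *\<^sub>R F k"]) (simp add: scaleR_sum_right)
qed

lemma separable_outer_product: "separable (outer_product (product_vector x y w))"
proof (cases "product_vector x y w = 0")
  case True
  then have "outer_product (product_vector x y w) = 0"
    by (simp add: outer_product_def vec_eq_iff)
  then show ?thesis by (simp add: separable_0)
next
  case False
  then have "pure_product_state (outer_product (product_vector x y w))"
    unfolding pure_product_state_def
    by (intro exI[of _ "(norm (product_vector x y w))\<^sup>2"] exI[of _ x] exI[of _ y] exI[of _ w])
      (simp add: rank_one_projection_def outer_product_def)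
  then show ?thesis unfolding separable_def
    by (intro exI[of _ 1] exI[of _ "\<lambda>_. outer_product (product_vector x y w)"]) simp
qed

lemma pure_product_state_imp_outer_product:
  assumes "pure_product_state A"
  shows "\<exists>x y w. A = outer_product (product_vector x y w)"
proof -
  obtain t x y w where t: "0 < t" and A: "A = t *\<^sub>R rank_one_projection (product_vector x y w)"
    using assms by (auto simp: pure_product_state_def)
  define N where "N = (norm (product_vector x y w))\<^sup>2"
  \<comment> \<open>The scalar is absorbed into the first factor; the outer product is quadratic,
    hence the square root.\<close>
  define s where "s = sqrt (t / N)"
  have "s * s = t / N" using t by (simp add: s_def N_def)
  moreover have "outer_product (product_vector (s *\<^sub>R x) y w) = (s * s) *\<^sub>R outer_product (product_vector x y w)"
    by (simp add: outer_product_def product_vector_def vec_eq_iff)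
  ultimately have "A = outer_product (product_vector (s *\<^sub>R x) y w)"
    unfolding A rank_one_projection_def N_def[symmetric] by (simp add: outer_product_def)
  then show ?thesis by blast
qed

section \<open>Explicit separable matrices of X form\<close>

definition qubit :: "complex \<Rightarrow> complex \<Rightarrow> complex ^ 2" where
  "qubit x0 x1 = (\<chi> i. if i = 0 then x0 else x1)"

text \<open>Applied to both indices, this reduces a matrix identity to its 64 entries.\<close>

lemma forall_bits3:
  "(\<forall>p :: bits3. P p) \<longleftrightarrow>
    P (0,0,0) \<and> P (0,0,1) \<and> P (0,1,0) \<and> P (0,1,1) \<and> P (1,0,0) \<and> P (1,0,1) \<and> P (1,1,0) \<and> P (1,1,1)"
proof -
  have "(\<forall>i :: 2. Q i) \<longleftrightarrow> Q 0 \<and> Q 1" for Q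
    using exhaust_2[of 0] zero_neq_one[where 'a = 2] forall_2[of Q] by metis
  then show ?thesis by (simp only: split_paired_All conj_assoc)
qed

lemma lex_pos_simps:
  "lex_pos (0,0,0) = 0" "lex_pos (0,0,1) = 1" "lex_pos (0,1,0) = 2" "lex_pos (0,1,1) = 3"
  "lex_pos (1,0,0) = 4" "lex_pos (1,0,1) = 5" "lex_pos (1,1,0) = 6" "lex_pos (1,1,1) = 7"
  by (simp_all add: lex_pos_def bit_val_def)

lemma product_vector_qubit:
  "product_vector (qubit x0 x1) (qubit y0 y1) (qubit w0 w1) $ (i, j, k) =
    (if i = 0 then x0 else x1) * (if j = 0 then y0 else y1) * (if k = 0 then w0 else w1)"
  by (simp add: product_vector_def qubit_def)

text \<open>The projections onto the standard basis vectors are product states, and a nonnegative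
  diagonal matrix is a nonnegative combination of them.\<close>

lemma separable_X_matrix_0:
  assumes "\<And>i. 0 \<le> a $ i" "\<And>i. 0 \<le> b $ i"
  shows "separable (X_matrix a b 0)"
proof -
  define d where "d = [a$1, a$2, a$3, a$4, b$4, b$3, b$2, b$1]"
  \<comment> \<open>\<open>True\<close> encodes the bit 1, and the number passed to \<open>D\<close>
    is the lexicographic position of the basis vector.\<close>
  define E :: "bool \<Rightarrow> complex ^ 2" where "E = (\<lambda>s. if s then qubit 0 1 else qubit 1 0)"
  define D where "D = (\<lambda>n s t u. (d ! n) *\<^sub>R outer_product (product_vector (E s) (E t) (E u)))"
  have "X_matrix a b 0 = D 0 False False False + D 1 False False True + D 2 False True False
    + D 3 False True True + D 4 True False False + D 5 True False True + D 6 True True False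
    + D 7 True True True"
    unfolding vec_eq_iff forall_bits3
    by (simp add: X_matrix_def lex_pos_simps D_def E_def d_def outer_product_def product_vector_qubit
        scaleR_conv_of_real[where 'a = complex])
  moreover have "separable (D n s t u)" if "n < 8" for n s t u
  proof -
    have "length d = 8" by (simp add: d_def)
    then have "d ! n \<in> set d" using that by (metis nth_mem)
    then have "0 \<le> d ! n" using assms by (auto simp: d_def)
    then show ?thesis unfolding D_def by (intro separable_scaleR separable_outer_product)
  qed
  ultimately show ?thesis by (simp add: separable_add)
qed

text \<open>
  Averaging the projection over the sign changes \<open>(x\<^sub>1, y\<^sub>1, w\<^sub>1) \<mapsto> (s t x\<^sub>1, s y\<^sub>1, t w\<^sub>1)\<close>
  kills every entry off the diagonal and the anti-diagonal and fixes the others.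
\<close>

lemma separable_X_matrix_product:
  assumes
    "complex_of_real (a$1) = x0 * y0 * w0 * cnj (x0 * y0 * w0)"
    "complex_of_real (a$2) = x0 * y0 * w1 * cnj (x0 * y0 * w1)"
    "complex_of_real (a$3) = x0 * y1 * w0 * cnj (x0 * y1 * w0)"
    "complex_of_real (a$4) = x0 * y1 * w1 * cnj (x0 * y1 * w1)"
    "complex_of_real (b$4) = x1 * y0 * w0 * cnj (x1 * y0 * w0)"
    "complex_of_real (b$3) = x1 * y0 * w1 * cnj (x1 * y0 * w1)"
    "complex_of_real (b$2) = x1 * y1 * w0 * cnj (x1 * y1 * w0)"
    "complex_of_real (b$1) = x1 * y1 * w1 * cnj (x1 * y1 * w1)"
    "c$1 = x0 * y0 * w0 * cnj (x1 * y1 * w1)"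
    "c$2 = x0 * y0 * w1 * cnj (x1 * y1 * w0)"
    "c$3 = x0 * y1 * w0 * cnj (x1 * y0 * w1)"
    "c$4 = x0 * y1 * w1 * cnj (x1 * y0 * w0)"
  shows "separable (X_matrix a b c)"
proof -
  define V where "V = (\<lambda>s t. outer_product
    (product_vector (qubit x0 (s * t * x1)) (qubit y0 (s * y1)) (qubit w0 (t * w1))))"
  have "X_matrix a b c = (1/4) *\<^sub>R (V 1 1 + V 1 (-1) + V (-1) 1 + V (-1) (-1))"
    unfolding vec_eq_iff forall_bits3
    by (simp add: X_matrix_def lex_pos_simps V_def outer_product_def product_vector_qubit
        scaleR_conv_of_real[where 'a = complex] assms)
  then show ?thesis unfolding V_def
    by (auto intro!: separable_scaleR separable_add separable_outer_product)
qed

text \<open>The product vector is that of (p, q cnj X), (1, g cnj Y) and (1, h cnj W). The phases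
  sit in the second components, which the anti-diagonal entries c1 to c4 see through x1
  conjugated.\<close>

lemma separable_X_matrix_moduli_phases:
  fixes p q g h :: real and X Y W :: complex
  assumes "cmod X = 1" "cmod Y = 1" "cmod W = 1"
    and "a$1 = p\<^sup>2" "a$2 = p\<^sup>2 * h\<^sup>2" "a$3 = p\<^sup>2 * g\<^sup>2" "a$4 = p\<^sup>2 * g\<^sup>2 * h\<^sup>2"
    and "b$4 = q\<^sup>2" "b$3 = q\<^sup>2 * h\<^sup>2" "b$2 = q\<^sup>2 * g\<^sup>2" "b$1 = q\<^sup>2 * g\<^sup>2 * h\<^sup>2"
    and "c$1 = complex_of_real (p * q * g * h) * (X * Y * W)" "c$2 = complex_of_real (p * q * g * h) * (X * Y * cnj W)"
      "c$3 = complex_of_real (p * q * g * h) * (X * cnj Y * W)" "c$4 = complex_of_real (p * q * g * h) * (X * cnj Y * cnj W)"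
  shows "separable (X_matrix a b c)"
proof -
  have "X * cnj X = 1" "Y * cnj Y = 1" "W * cnj W = 1"
    using assms by (simp_all add: complex_norm_square[symmetric])
  then have unit: "X * (cnj X * z) = z" "Y * (cnj Y * z) = z" "W * (cnj W * z) = z" for z
    by (simp_all add: mult.assoc[symmetric])
  show ?thesis
    by (rule separable_X_matrix_product[where ?x0.0 = p and ?x1.0 = "q * cnj X" and ?y0.0 = 1
          and ?y1.0 = "g * cnj Y" and ?w0.0 = 1 and ?w1.0 = "h * cnj W"])
      (simp_all add: assms unit power2_eq_square mult_ac)
qed

lemma X_matrix_add: "X_matrix a b c + X_matrix a' b' c' = X_matrix (a + a') (b + b') (c + c')"
  unfolding vec_eq_iff forall_bits3 by (simp add: X_matrix_def lex_pos_simps)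

lemma X_matrix_scaleR: "t *\<^sub>R X_matrix a b c = X_matrix (t *\<^sub>R a) (t *\<^sub>R b) (t *\<^sub>R c)"
  unfolding vec_eq_iff forall_bits3
  by (simp add: X_matrix_def lex_pos_simps scaleR_conv_of_real[where 'a = complex])

lemma convex_separable_X_matrix: "convex {c. separable (X_matrix a b c)}"
proof (rule convexI, safe)
  fix c c' and s t :: real
  assume "separable (X_matrix a b c)" "separable (X_matrix a b c')" and st: "0 \<le> s" "0 \<le> t" "s + t = 1"
  then have "separable (s *\<^sub>R X_matrix a b c + t *\<^sub>R X_matrix a b c')"
    by (intro separable_add separable_scaleR)
  then show "separable (X_matrix a b (s *\<^sub>R c + t *\<^sub>R c'))"
    using st by (simp add: X_matrix_scaleR X_matrix_add scaleR_add_left[symmetric])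
qed

subsection \<open>Sufficiency\<close>

text \<open>The choice is the least \<open>x\<close> at or above \<open>l\<close> for which P / x
  does not exceed \<open>b\<close>; the bounds on \<open>P\<close> place both factors in their
  intervals.\<close>

lemma exists_between_with_product:
  fixes l m a b P :: real
  assumes "0 < l" "0 < m" "l \<le> a" "m \<le> b" "l * m \<le> P" "P \<le> a * b"
  obtains x y where "l \<le> x" "x \<le> a" "m \<le> y" "y \<le> b" "x * y = P"
proof -
  define x where "x = max l (P / b)"
  have b: "0 < b" and x: "0 < x" using assms by (auto simp: x_def)
  have "P / b \<le> x" by (simp add: x_def)
  then have "P / x \<le> b" using b x by (simp add: field_simps)
  moreover have "m \<le> P / x"
  proof -
    have "0 < P" using assms mult_pos_pos[of l m] by linarith
    then have "P / b * m \<le> P"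
      using assms b by (simp add: field_simps)
    then have "x * m \<le> P" using assms by (simp add: x_def max_def)
    then show ?thesis using x by (simp add: field_simps)
  qed
  moreover have "x \<le> a" using assms b by (simp add: x_def field_simps)
  ultimately show ?thesis using that[of x "P / x"] x by (simp add: x_def)
qed

text \<open>The equations force X^2 = u1 u4 and Y^2 = u1 cnj u3. Any choice of the roots works,
  since \<open>W\<close> is then solved from the first equation; the torus relation yields the
  second.\<close>

lemma exists_torus_phases:
  assumes "u \<in> phase_torus 1"
  obtains X Y W where "cmod X = 1" "cmod Y = 1" "cmod W = 1"
    "u$1 = X * Y * W" "u$2 = X * Y * cnj W" "u$3 = X * cnj Y * W" "u$4 = X * cnj Y * cnj W"
proof
  have unit: "cmod (u $ i) = 1" for i using assms by (simp add: phase_torus_def)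
  have prod: "u$1 * u$4 = u$2 * u$3" using assms by (simp add: phase_torus_def)
  define X where "X = csqrt (u$1 * u$4)"
  define Y where "Y = csqrt (u$1 * cnj (u$3))"
  define W where "W = u$1 * cnj X * cnj Y"
  have XX: "X * X = u$1 * u$4" and YY: "Y * Y = u$1 * cnj (u$3)"
    by (simp_all add: X_def Y_def power2_eq_square[symmetric])
  have sqrt_unit: "cmod z = 1" if "z * z = v" "cmod v = 1" for z v
  proof -
    have "(cmod z)\<^sup>2 = 1" using that by (simp add: power2_eq_square norm_mult[symmetric])
    then show ?thesis using norm_ge_zero[of z] unfolding power2_eq_1_iff by linarith
  qed
  show X: "cmod X = 1" by (rule sqrt_unit[OF XX]) (simp add: norm_mult unit)
  show Y: "cmod Y = 1" by (rule sqrt_unit[OF YY]) (simp add: norm_mult unit)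
  show "cmod W = 1" using X Y unit by (simp add: W_def norm_mult)
  have cnj_unit: "z * cnj z = 1" if "cmod z = 1" for z
    using that by (simp add: complex_norm_square[symmetric])
  have cW: "cnj W = cnj (u$1) * X * Y" by (simp add: W_def)
  note c = cnj_unit[OF X] cnj_unit[OF Y] cnj_unit[OF unit[of 1]] cnj_unit[OF unit[of 3]]
  show "u$1 = X * Y * W" unfolding W_def using c by algebra
  show "u$2 = X * Y * cnj W" unfolding cW using c XX YY prod by algebra
  show "u$3 = X * cnj Y * W" unfolding W_def using c YY by algebra
  show "u$4 = X * cnj Y * cnj W" unfolding cW using c XX by algebra
qed

lemma separable_X_matrix_torus_tight:
  assumes r: "0 < r" and C: "C \<in> phase_torus r"
    and a: "\<And>i. 0 < a $ i" and prod: "a$1 * a$4 = a$2 * a$3" and b: "\<And>i. b $ i = r\<^sup>2 / a $ i"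
  shows "separable (X_matrix a b C)"
proof -
  define u :: "complex ^ 4" where "u = (\<chi> i. C $ i / complex_of_real r)"
  have "u \<in> phase_torus 1"
    using C r by (simp add: phase_torus_def u_def norm_divide)
  then obtain X Y W where XYW: "cmod X = 1" "cmod Y = 1" "cmod W = 1"
    "u$1 = X * Y * W" "u$2 = X * Y * cnj W" "u$3 = X * cnj Y * W" "u$4 = X * cnj Y * cnj W"
    by (rule exists_torus_phases)
  have Cu: "C $ i = r * u $ i" for i using r by (simp add: u_def)
  \<comment> \<open>The moduli are read off from a1, a2 and a3; the relation a1 a4 = a2 a3 then
    gives a4, and \<open>q\<close> is fixed by p q g h = r, which gives all of
    \<open>b\<close>.\<close>
  define p where "p = sqrt (a$1)"
  define h where "h = sqrt (a$2 / a$1)"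
  define g where "g = sqrt (a$3 / a$1)"
  define q where "q = r / (p * g * h)"
  have pos: "0 < p" "0 < h" "0 < g" using a by (simp_all add: p_def h_def g_def)
  have sq: "p\<^sup>2 = a$1" "h\<^sup>2 = a$2 / a$1" "g\<^sup>2 = a$3 / a$1"
    using a less_imp_le[OF a] by (simp_all add: p_def h_def g_def)
  have ne: "a $ i \<noteq> 0" for i using a[of i] by simp
  have a4: "a$4 = a$2 * a$3 / a$1" using prod ne[of 1] by (simp add: field_simps)
  have q2: "q\<^sup>2 = r\<^sup>2 / (a$2 * a$3 / a$1)"
    unfolding q_def power_divide power_mult_distrib sq using ne by (simp add: field_simps)
  have pqgh: "p * q * g * h = r" using pos by (simp add: q_def)
  have "C$1 = complex_of_real (p * q * g * h) * (X * Y * W)" "C$2 = complex_of_real (p * q * g * h) * (X * Y * cnj W)"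
    "C$3 = complex_of_real (p * q * g * h) * (X * cnj Y * W)" "C$4 = complex_of_real (p * q * g * h) * (X * cnj Y * cnj W)"
    unfolding pqgh by (simp_all only: Cu XYW)
  then show ?thesis
    by (intro separable_X_matrix_moduli_phases[OF XYW(1-3), where p = p and q = q and g = g and h = h])
      (use ne in \<open>simp_all add: b a4 sq q2 field_simps\<close>)
qed

lemma separable_X_matrix_torus:
  assumes r: "0 < r" and C: "C \<in> phase_torus r"
    and a: "\<And>i. 0 \<le> a $ i" and b: "\<And>i. 0 \<le> b $ i" and ab: "\<And>i. r\<^sup>2 \<le> a $ i * b $ i"
    and 1: "r ^ 4 \<le> a$1 * b$2 * b$3 * a$4" and 2: "r ^ 4 \<le> b$1 * a$2 * a$3 * b$4"
  shows "separable (X_matrix a b C)"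
proof -
  have "0 < a $ i \<and> 0 < b $ i" for i
  proof -
    have "0 < r\<^sup>2" using r by simp
    then have "0 < a $ i * b $ i" using ab[of i] by linarith
    then show ?thesis using a[of i] b[of i] unfolding zero_less_mult_iff by linarith
  qed
  then have apos: "0 < a $ i" and bpos: "0 < b $ i" for i by simp_all
  \<comment> \<open>\<open>l i\<close> is the least positive value of the shrunken entry
    \<open>a' $ i\<close> for which its partner r^2 / a'_i still fits below
    \<open>b $ i\<close>.\<close>
  define l where "l = (\<lambda>i. r\<^sup>2 / b $ i)"
  have l: "0 < l i" "l i \<le> a $ i" for i
    using r bpos[of i] ab[of i] by (simp_all add: l_def field_simps)
  \<comment> \<open>The intervals of admissible values of \<open>x1 * x4\<close> and of \<open>x2 * x3\<close> intersect.\<close>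
  define P where "P = max (l 1 * l 4) (l 2 * l 3)"
  have "l 1 * l 4 \<le> a$1 * a$4" "l 2 * l 3 \<le> a$2 * a$3"
    using l a by (simp_all add: mult_mono less_imp_le)
  \<comment> \<open>With denominators cleared, these crossed bounds are the quartic hypotheses
    \<open>2\<close> and \<open>1\<close>, in this order.\<close>
  moreover have "l 1 * l 4 \<le> a$2 * a$3" "l 2 * l 3 \<le> a$1 * a$4"
    using 1 2 bpos by (simp_all add: l_def field_simps power2_eq_square power4_eq_xxxx)
  ultimately have P: "l 1 * l 4 \<le> P" "P \<le> a$1 * a$4" "l 2 * l 3 \<le> P" "P \<le> a$2 * a$3"
    by (simp_all add: P_def)
  obtain x1 x4 where x14: "l 1 \<le> x1" "x1 \<le> a$1" "l 4 \<le> x4" "x4 \<le> a$4" "x1 * x4 = P"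
    using exists_between_with_product[OF l(1) l(1) l(2) l(2) P(1,2)] .
  obtain x2 x3 where x23: "l 2 \<le> x2" "x2 \<le> a$2" "l 3 \<le> x3" "x3 \<le> a$3" "x2 * x3 = P"
    using exists_between_with_product[OF l(1) l(1) l(2) l(2) P(3,4)] .
  define a' :: "real ^ 4" where "a' = vector [x1, x2, x3, x4]"
  define b' :: "real ^ 4" where "b' = (\<chi> i. r\<^sup>2 / a' $ i)"
  have la': "\<forall>i. l i \<le> a' $ i" and a'a: "\<forall>i. a' $ i \<le> a $ i"
    using x14 x23 by (simp_all add: a'_def forall_4 vector_4)
  then have a'pos: "0 < a' $ i" for i using l(1)[of i] by (meson less_le_trans)
  have b'b: "b' $ i \<le> b $ i" for i
  proof -
    have "r\<^sup>2 / b $ i \<le> a' $ i" using la' by (simp add: l_def)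
    then show ?thesis using a'pos[of i] bpos[of i] by (simp add: b'_def field_simps)
  qed
  have "separable (X_matrix a' b' C)"
    using r C a'pos x14 x23
    by (intro separable_X_matrix_torus_tight) (auto simp: a'_def b'_def vector_4)
  moreover have "separable (X_matrix (a - a') (b - b') 0)"
    using a'a b'b by (intro separable_X_matrix_0) simp_all
  ultimately have "separable (X_matrix a' b' C + X_matrix (a - a') (b - b') 0)"
    by (rule separable_add)
  then show ?thesis by (simp add: X_matrix_add)
qed

lemma le_Delta_iff:
  assumes "\<And>i. 0 \<le> a $ i" "\<And>i. 0 \<le> b $ i" "0 \<le> r"
  shows "r \<le> Delta a b \<longleftrightarrow> (\<forall>i. r\<^sup>2 \<le> a $ i * b $ i) \<and>
    r ^ 4 \<le> a$1 * b$2 * b$3 * a$4 \<and> r ^ 4 \<le> b$1 * a$2 * a$3 * b$4"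
proof -
  have sqrt: "r \<le> sqrt x \<longleftrightarrow> r\<^sup>2 \<le> x" if "0 \<le> x" for x
    using assms(3) real_sqrt_le_iff[of "r\<^sup>2" x] by simp
  have root: "r \<le> root 4 x \<longleftrightarrow> r ^ 4 \<le> x" if "0 \<le> x" for x
    using that assms(3) real_root_le_iff[of 4 "r ^ 4" x] by (simp add: real_root_power_cancel)
  show ?thesis
    using assms by (simp add: Delta_def forall_4 sqrt root)
qed

lemma X_dual_norm_le_Delta_imp_separable:
  assumes a: "\<And>i. 0 \<le> a $ i" and b: "\<And>i. 0 \<le> b $ i" and le: "X_dual_norm c \<le> Delta a b"
  shows "separable (X_matrix a b c)"
proof -
  let ?r = "X_dual_norm c"
  note le' = le[unfolded le_Delta_iff[OF a b X_dual_norm_nonneg]]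
  have "separable (X_matrix a b C)" if C: "C \<in> phase_torus ?r" for C
  proof (cases "?r = 0")
    case True
    then have "C = 0" using C by (simp add: phase_torus_def vec_eq_iff)
    then show ?thesis using a b separable_X_matrix_0 by simp
  next
    case False
    then have "0 < ?r" using X_dual_norm_nonneg[of c] by linarith
    then show ?thesis using le' by (intro separable_X_matrix_torus[OF _ C a b]) auto
  qed
  then have "convex hull (phase_torus ?r) \<subseteq> {C. separable (X_matrix a b C)}"
    by (intro hull_minimal convex_separable_X_matrix) auto
  then show ?thesis using in_convex_hull_phase_torus by blast
qed

subsection \<open>Necessity\<close>

text \<open>Cauchy-Schwarz twice: first with |r k| split as sqrt (f g) times sqrt (h l), then on the
  sums of f g and of h l.\<close>

lemma Cauchy_Schwarz_sum4:
  fixes f g h l :: "'a \<Rightarrow> real"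
  assumes "\<And>k. 0 \<le> f k" "\<And>k. 0 \<le> g k" "\<And>k. 0 \<le> h k" "\<And>k. 0 \<le> l k"
    and r: "\<And>k. (r k)\<^sup>2 = f k * g k * h k * l k"
  shows "(\<Sum>k\<in>I. r k) ^ 4 \<le> (\<Sum>k\<in>I. (f k)\<^sup>2) * (\<Sum>k\<in>I. (g k)\<^sup>2) * (\<Sum>k\<in>I. (h k)\<^sup>2) * (\<Sum>k\<in>I. (l k)\<^sup>2)"
proof -
  have "(\<Sum>k\<in>I. r k)\<^sup>2 \<le> (\<Sum>k\<in>I. sqrt (f k * g k) * sqrt (h k * l k))\<^sup>2"
  proof -
    have "\<bar>r k\<bar> = sqrt (f k * g k) * sqrt (h k * l k)" for k
    proof -
      have "\<bar>r k\<bar> = sqrt ((f k * g k) * (h k * l k))"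
        by (simp only: real_sqrt_abs[symmetric] r mult.assoc)
      then show ?thesis by (simp only: real_sqrt_mult[of "f k * g k" "h k * l k"])
    qed
    then have "\<bar>\<Sum>k\<in>I. r k\<bar> \<le> (\<Sum>k\<in>I. sqrt (f k * g k) * sqrt (h k * l k))"
      using sum_abs[of r I] by simp
    then show ?thesis unfolding abs_le_square_iff[symmetric] by linarith
  qed
  also have "\<dots> \<le> (\<Sum>k\<in>I. (sqrt (f k * g k))\<^sup>2) * (\<Sum>k\<in>I. (sqrt (h k * l k))\<^sup>2)"
    by (rule Cauchy_Schwarz_ineq_sum)
  also have "\<dots> = (\<Sum>k\<in>I. f k * g k) * (\<Sum>k\<in>I. h k * l k)"
    using assms(1-4) by simp
  finally have "((\<Sum>k\<in>I. r k)\<^sup>2)\<^sup>2 \<le> ((\<Sum>k\<in>I. f k * g k) * (\<Sum>k\<in>I. h k * l k))\<^sup>2"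
    by (intro power_mono) simp_all
  also have "\<dots> = (\<Sum>k\<in>I. f k * g k)\<^sup>2 * (\<Sum>k\<in>I. h k * l k)\<^sup>2"
    by (simp add: power_mult_distrib)
  also have "\<dots> \<le> ((\<Sum>k\<in>I. (f k)\<^sup>2) * (\<Sum>k\<in>I. (g k)\<^sup>2)) * ((\<Sum>k\<in>I. (h k)\<^sup>2) * (\<Sum>k\<in>I. (l k)\<^sup>2))"
    by (intro mult_mono Cauchy_Schwarz_ineq_sum) (simp_all add: sum_nonneg)
  finally have "((\<Sum>k\<in>I. r k)\<^sup>2)\<^sup>2 \<le> ((\<Sum>k\<in>I. (f k)\<^sup>2) * (\<Sum>k\<in>I. (g k)\<^sup>2)) * ((\<Sum>k\<in>I. (h k)\<^sup>2) * (\<Sum>k\<in>I. (l k)\<^sup>2))" .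
  moreover have "((\<Sum>k\<in>I. r k)\<^sup>2)\<^sup>2 = (\<Sum>k\<in>I. r k) ^ 4"
    using power_mult[of "\<Sum>k\<in>I. r k" 2 2] by simp
  ultimately show ?thesis by (simp only: mult.assoc)
qed

lemma X_matrix_entries:
  "X_matrix a b c $ (0,0,0) $ (0,0,0) = a$1" "X_matrix a b c $ (0,0,1) $ (0,0,1) = a$2"
  "X_matrix a b c $ (0,1,0) $ (0,1,0) = a$3" "X_matrix a b c $ (0,1,1) $ (0,1,1) = a$4"
  "X_matrix a b c $ (1,0,0) $ (1,0,0) = b$4" "X_matrix a b c $ (1,0,1) $ (1,0,1) = b$3"
  "X_matrix a b c $ (1,1,0) $ (1,1,0) = b$2" "X_matrix a b c $ (1,1,1) $ (1,1,1) = b$1"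
  "X_matrix a b c $ (0,0,0) $ (1,1,1) = c$1" "X_matrix a b c $ (0,0,1) $ (1,1,0) = c$2"
  "X_matrix a b c $ (0,1,0) $ (1,0,1) = c$3" "X_matrix a b c $ (0,1,1) $ (1,0,0) = c$4"
  by (simp_all add: X_matrix_def lex_pos_simps)

lemma state_diagonal_nonneg:
  assumes "state A"
  shows "0 \<le> Re (A $ p $ p)"
proof -
  define v :: three_qubit_vector where "v = axis p 1"
  have "(\<Sum>q\<in>UNIV. cnj (v $ q) * (A *v v) $ q) = (\<Sum>q\<in>UNIV. if q = p then (A *v v) $ q else 0)"
    by (intro sum.cong) (simp_all add: v_def axis_def)
  also have "\<dots> = (A *v v) $ p" by simp
  also have "\<dots> = (\<Sum>q\<in>UNIV. A $ p $ q * v $ q)" by (simp add: matrix_vector_mult_def)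
  also have "\<dots> = (\<Sum>q\<in>UNIV. if q = p then A $ p $ q else 0)"
    by (intro sum.cong) (simp_all add: v_def axis_def)
  also have "\<dots> = A $ p $ p" by simp
  finally have eq: "(\<Sum>q\<in>UNIV. cnj (v $ q) * (A *v v) $ q) = A $ p $ p" .
  have "0 \<le> Re (\<Sum>q\<in>UNIV. cnj (v $ q) * (A *v v) $ q)"
    using assms unfolding state_def by blast
  then show ?thesis unfolding eq .
qed

text \<open>Supplies the signs under which the roots in \<open>Delta\<close> become polynomial
  inequalities.\<close>

lemma state_X_matrix_nonneg:
  assumes "state (X_matrix a b c)"
  shows "0 \<le> a $ i" "0 \<le> b $ i"
proof -
  note n = state_diagonal_nonneg[OF assms]
  have "\<forall>i. 0 \<le> a $ i" "\<forall>i. 0 \<le> b $ i"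
    using n[of "(0,0,0)"] n[of "(0,0,1)"] n[of "(0,1,0)"] n[of "(0,1,1)"]
      n[of "(1,0,0)"] n[of "(1,0,1)"] n[of "(1,1,0)"] n[of "(1,1,1)"]
    by (simp_all add: X_matrix_entries forall_4)
  then show "0 \<le> a $ i" "0 \<le> b $ i" by simp_all
qed

text \<open>The sum \<open>R\<close> of the anti-diagonal moduli of the product terms separates the
  two sides: Cauchy-Schwarz gives R \<le> \<open>Delta a b\<close>, and the triangle inequality
  bounds the dual norm by \<open>R\<close>.\<close>

lemma separable_imp_X_dual_norm_le_Delta:
  assumes a: "\<And>i. 0 \<le> a $ i" and b: "\<And>i. 0 \<le> b $ i" and sep: "separable (X_matrix a b c)"
  shows "X_dual_norm c \<le> Delta a b"
proof -
  obtain n :: nat and F where F: "\<forall>k<n. pure_product_state (F k)" "X_matrix a b c = (\<Sum>k<n. F k)"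
    using sep unfolding separable_def by blast
  \<comment> \<open>With the bound on \<open>k\<close> inside, choice gives vectors for every
    \<open>k\<close>; those from \<open>n\<close> on are arbitrary but still product
    vectors.\<close>
  then have "\<forall>k. \<exists>x y w. k < n \<longrightarrow> F k = outer_product (product_vector x y w)"
    using pure_product_state_imp_outer_product by blast
  then obtain x y w where Fk: "\<And>k. k < n \<Longrightarrow> F k = outer_product (product_vector (x k) (y k) (w k))"
    by metis
  define v where "v = (\<lambda>k. product_vector (x k) (y k) (w k))"
  define m where "m = (\<lambda>p k. cmod (v k $ p))"
  have entry: "X_matrix a b c $ p $ q = (\<Sum>k<n. v k $ p * cnj (v k $ q))" for p q
    unfolding F(2) by (simp add: Fk outer_product_def v_def)
  have diag: "Re (X_matrix a b c $ p $ p) = (\<Sum>k<n. (m p k)\<^sup>2)" for p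
    by (simp only: entry Re_sum complex_norm_square[symmetric] Re_complex_of_real m_def)
  note sums = diag[of "(0,0,0)"] diag[of "(0,0,1)"] diag[of "(0,1,0)"] diag[of "(0,1,1)"]
    diag[of "(1,0,0)"] diag[of "(1,0,1)"] diag[of "(1,1,0)"] diag[of "(1,1,1)"]
  note sums = sums[unfolded X_matrix_entries Re_complex_of_real]
  \<comment> \<open>For a product vector, all four pairs of complementary bit strings give the same
    value |x0 x1 y0 y1 w0 w1|.\<close>
  define r where "r = (\<lambda>k. m (0,0,0) k * m (1,1,1) k)"
  have r: "r k = m (0,0,0) k * m (1,1,1) k" "r k = m (0,0,1) k * m (1,1,0) k" "r k = m (0,1,0) k * m (1,0,1) k"
    "r k = m (0,1,1) k * m (1,0,0) k" for k
    by (simp_all add: r_def m_def v_def product_vector_def norm_mult)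
  define R where "R = (\<Sum>k<n. r k)"
  have m0: "0 \<le> m p k" for p k by (simp add: m_def)
  have R0: "0 \<le> R" by (simp add: R_def r_def m0 sum_nonneg)
  have "R\<^sup>2 \<le> (\<Sum>k<n. (m p k)\<^sup>2) * (\<Sum>k<n. (m q k)\<^sup>2)" if "\<And>k. r k = m p k * m q k" for p q
    unfolding R_def that by (rule Cauchy_Schwarz_ineq_sum)
  from this[OF r(1)] this[OF r(2)] this[OF r(3)] this[OF r(4)]
  have "\<forall>i. R\<^sup>2 \<le> a $ i * b $ i" by (simp add: forall_4 sums)
  \<comment> \<open>The entries a1, b2, b3, a4 belong to the bit strings of even parity, in which
    each bit takes each value twice, so their moduli multiply to the square of \<open>r k\<close>.
    The next bound uses odd parity.\<close>
  moreover have "R ^ 4 \<le> a$1 * b$2 * b$3 * a$4"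
    unfolding R_def sums
    by (rule Cauchy_Schwarz_sum4[OF m0 m0 m0 m0])
      (simp add: r_def m_def v_def product_vector_def norm_mult power2_eq_square mult_ac)
  moreover have "R ^ 4 \<le> b$1 * a$2 * a$3 * b$4"
    unfolding R_def sums
    by (rule Cauchy_Schwarz_sum4[OF m0 m0 m0 m0])
      (simp add: r_def m_def v_def product_vector_def norm_mult power2_eq_square mult_ac)
  ultimately have R_le: "R \<le> Delta a b" using le_Delta_iff[OF a b R0] by blast
  \<comment> \<open>\<open>C k\<close> is the upper half of the anti-diagonal of the k-th product
    term.\<close>
  define C :: "nat \<Rightarrow> complex ^ 4" where "C = (\<lambda>k. vector
    [v k $ (0,0,0) * cnj (v k $ (1,1,1)), v k $ (0,0,1) * cnj (v k $ (1,1,0)),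
     v k $ (0,1,0) * cnj (v k $ (1,0,1)), v k $ (0,1,1) * cnj (v k $ (1,0,0))])"
  have C: "C k \<in> phase_torus (r k)" for k
    by (simp add: phase_torus_def C_def forall_4 vector_4 r_def m_def v_def product_vector_def norm_mult)
  have "\<forall>i. c $ i = (\<Sum>k<n. C k $ i)"
    using entry[of "(0,0,0)" "(1,1,1)"] entry[of "(0,0,1)" "(1,1,0)"]
      entry[of "(0,1,0)" "(1,0,1)"] entry[of "(0,1,1)" "(1,0,0)"]
    by (simp add: forall_4 C_def vector_4 X_matrix_entries)
  then have c: "c $ i = (\<Sum>k<n. C k $ i)" for i by simp
  have "X_dual_norm c \<le> R"
    unfolding X_dual_norm_def
  proof (rule cSUP_least[OF X_norm_1_nonempty])
    fix z assume "z \<in> {z. X_norm z = 1}"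
    then have z: "X_norm z = 1" by simp
    have "(\<Sum>i\<in>UNIV. c $ i * z $ i) = (\<Sum>k<n. \<Sum>i\<in>UNIV. C k $ i * z $ i)"
      unfolding c sum_distrib_right by (rule sum.swap)
    also have "cmod \<dots> \<le> R"
      unfolding R_def using cmod_pairing_torus_le[OF C, of _ z] z by (intro sum_norm_le) simp
    finally show "cmod (\<Sum>i\<in>UNIV. c $ i * z $ i) \<le> R" .
  qed
  then show ?thesis using R_le by simp
qed

theorem theorem3p2:
  fixes a b :: "real ^ 4" and c :: "complex ^ 4"
  assumes "state (X_matrix a b c)"
  shows "separable (X_matrix a b c) \<longleftrightarrow> Delta a b \<ge> X_dual_norm c"
proof
  note nonneg = state_X_matrix_nonneg[OF assms]
  show "Delta a b \<ge> X_dual_norm c" if "separable (X_matrix a b c)"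
    by (rule separable_imp_X_dual_norm_le_Delta[OF nonneg that])
  show "separable (X_matrix a b c)" if "Delta a b \<ge> X_dual_norm c"
    by (rule X_dual_norm_le_Delta_imp_separable[OF nonneg that])
qed

end
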